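(* Every ($2K_2$, claw)-free graph $G$ on $n$ vertices is recolorable, and the diameter of $R_\ell(G)$ is at most $2n^2$ for all $\ell\ge\chi(G)+1$.
   Context: All graphs are finite and simple. A $k$-coloring of $G$ is a map $V(G)\to\{1,\dots,k\}$ giving adjacent vertices different values; $\chi(G)$ is the chromatic number. $R_k(G)$ denotes the graph whose vertices are the $k$-colorings of $G$, two being adjacent if they differ in color on exactly one vertex. $G$ is recolorable if $R_\ell(G)$ is connected for all $\ell\ge\chi(G)+1$. A graph is $(H_1,H_2)$-free if it has no induced subgraph isomorphic to $H_1$ or $H_2$. $2K_2$ is the disjoint union of two edges; the claw is $K_{1,3}$. *)

theory Defs
  imports "Graph_Theory.Graph_Theory"
begin

text \<open>
  Finite simple graphs are the structures satisfying \<^const>\<open>pair_graph\<close>: a finite vertex set with a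
  symmetric, loop-free set of vertex pairs. Every edge is thus stored as two opposite arcs, and
  for such graphs \<^const>\<open>induced_subgraph\<close>, \<^const>\<open>digraph_iso\<close> and \<^const>\<open>Digraph_Component.connected\<close>
  are the usual undirected notions.
\<close>

definition two_K2 :: "nat pair_pre_digraph" where
  "two_K2 = \<lparr> pverts = {0, 1, 2, 3}, parcs = {(0, 1), (1, 0), (2, 3), (3, 2)} \<rparr>"

definition claw :: "nat pair_pre_digraph" where
  "claw = \<lparr> pverts = {0, 1, 2, 3}, parcs = {0} \<times> {1, 2, 3} \<union> {1, 2, 3} \<times> {0} \<rparr>"

definition induced_free :: "'b pair_pre_digraph \<Rightarrow> 'a pair_pre_digraph \<Rightarrow> bool" where
  "induced_free H G \<longleftrightarrow>
    \<not> (\<exists>K. induced_subgraph K (with_proj G) \<and> digraph_iso (with_proj H) K)"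

text \<open>
  Colorings are extensional functions on the vertex set, so that two colorings are equal as
  HOL functions iff they agree on all vertices.
\<close>

definition colorings :: "nat \<Rightarrow> 'a pair_pre_digraph \<Rightarrow> ('a \<Rightarrow> nat) set" where
  "colorings k G = {c \<in> pverts G \<rightarrow>\<^sub>E {1..k}. \<forall>(u, v) \<in> parcs G. c u \<noteq> c v}"

definition chromatic_number :: "'a pair_pre_digraph \<Rightarrow> nat" where
  "chromatic_number G = (LEAST k. colorings k G \<noteq> {})"

definition recoloring_graph :: "nat \<Rightarrow> 'a pair_pre_digraph \<Rightarrow> ('a \<Rightarrow> nat) pair_pre_digraph" where
  "recoloring_graph k G =
    \<lparr> pverts = colorings k G,
      parcs = {(c, d) \<in> colorings k G \<times> colorings k G. \<exists>!v. v \<in> pverts G \<and> c v \<noteq> d v} \<rparr>"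

definition recolorable :: "'a pair_pre_digraph \<Rightarrow> bool" where
  "recolorable G \<longleftrightarrow> (\<forall>l \<ge> chromatic_number G + 1.
    Digraph_Component.connected (with_proj (recoloring_graph l G)))"

text \<open>
  With unit arc costs, \<^const>\<open>wf_digraph.\<mu>\<close> is the length of a shortest walk, and \<open>\<infinity>\<close> if there is none.
\<close>

definition graph_diameter :: "('a, 'b) pre_digraph \<Rightarrow> ereal" where
  "graph_diameter H = (SUP u \<in> verts H. SUP v \<in> verts H. wf_digraph.\<mu> H (\<lambda>_. 1) u v)"

lemma pair_graph_two_K2: "pair_graph two_K2"
  by unfold_locales (auto simp: two_K2_def symmetric_def sym_def)

lemma complete_bipartite_claw: "K\<^bsub>1,3\<^esub> (with_proj claw)"
proof -
  have "pverts claw = {0} \<union> {1, 2, 3}" "{0} \<inter> {1, 2, 3 :: nat} = {}"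
    "card {0 :: nat} = 1" "card {1, 2, 3 :: nat} = 3"
    "parcs claw = {0} \<times> {1, 2, 3} \<union> {1, 2, 3} \<times> {0}"
    by (auto simp: claw_def)
  moreover have "finite (pverts claw)"
    by (simp add: claw_def)
  ultimately show ?thesis
    unfolding complete_bipartite_digraph_pair_def by blast
qed

lemma finite_colorings: "finite (pverts G) \<Longrightarrow> finite (colorings k G)"
  unfolding colorings_def by (rule finite_subset[of _ "pverts G \<rightarrow>\<^sub>E {1..k}"]) (auto intro: finite_PiE)

lemma pair_graph_recoloring_graph:
  assumes "pair_graph G"
  shows "pair_graph (recoloring_graph k G)"
proof -
  interpret G: pair_graph G by fact
  have fin: "finite (colorings k G)"
    by (rule finite_colorings[OF G.pair_finite_verts])
  show ?thesis
  proof unfold_locales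
    show "finite (parcs (recoloring_graph k G))"
      by (rule finite_subset[of _ "colorings k G \<times> colorings k G"])
        (auto simp: recoloring_graph_def fin)
    show "symmetric (with_proj (recoloring_graph k G))"
      unfolding symmetric_def sym_def by (simp add: recoloring_graph_def eq_commute)
  qed (auto simp: recoloring_graph_def fin)
qed

lemma colorings_chromatic_number:
  assumes "pair_graph G"
  shows "colorings (chromatic_number G) G \<noteq> {}"
proof -
  interpret G: pair_graph G by fact
  obtain h where "bij_betw h (pverts G) {1..card (pverts G)}"
    using ex_bij_betw_finite_nat[OF G.pair_finite_verts]
      bij_betw_iff_card[OF G.pair_finite_verts, of "{1..card (pverts G)}"] by auto
  then have inj: "inj_on h (pverts G)" and img: "h ` pverts G = {1..card (pverts G)}"
    by (auto simp: bij_betw_def)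
  have ends: "u \<in> pverts G \<and> v \<in> pverts G" if "(u, v) \<in> parcs G" for u v
    using G.in_arcsD1[OF that] G.in_arcsD2[OF that] by blast
  have "restrict h (pverts G) u \<noteq> restrict h (pverts G) v" if "(u, v) \<in> parcs G" for u v
    using inj_onD[OF inj, of u v] ends[OF that] G.no_loops'[OF that] by auto
  moreover have "restrict h (pverts G) \<in> pverts G \<rightarrow>\<^sub>E {1..card (pverts G)}"
    unfolding img[symmetric] by simp
  ultimately have "restrict h (pverts G) \<in> colorings (card (pverts G)) G"
    unfolding colorings_def by blast
  then have "\<exists>k. colorings k G \<noteq> {}"
    by blast
  then show ?thesis
    unfolding chromatic_number_def by (rule LeastI_ex)
qed

end

theory Submission
  imports Defs
begin

text \<open>
  Any two colorings are joined by a walk recoloring each vertex at most \<open>2n\<close> times. If \<open>G\<close> has an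
  independent triple, then there are nonadjacent \<open>v, w\<close> with \<open>N(v) \<subseteq> N(w)\<close>: give \<open>v\<close> the color of
  \<open>w\<close>, let it follow \<open>w\<close> along a walk for \<open>G - v\<close>, and finally give it its target color, at the cost of
  two extra moves of \<open>v\<close>. Otherwise color classes have at most two vertices, and any coloring reaches a
  fixed optimal one with at most \<open>n\<close> moves per vertex: free a color (along an augmenting path of
  the complement, if necessary), use it to clear the color of an optimal class, and install that class.
  Classes with two vertices go first, since they allow two moves of each remaining vertex; once all
  optimal classes are singletons, a free color always exists and one move suffices.
\<close>

lemma insert_psubset: "A \<subset> B - {x} \<Longrightarrow> x \<in> B \<Longrightarrow> insert x A \<subset> B"
  by blast

section \<open>Proper colorings of a symmetric irreflexive relation\<close>

locale adjacency =
  fixes adj :: "'a \<Rightarrow> 'a \<Rightarrow> bool"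
  assumes adj_sym: "adj u v \<Longrightarrow> adj v u"
    and adj_irrefl: "\<not> adj u u"
begin

text \<open>Vertex set and palette are arguments because the inductions delete vertices and colors.
  The palette \<open>UNIV\<close> leaves the colors unrestricted.\<close>

definition proper :: "'a set \<Rightarrow> nat set \<Rightarrow> ('a \<Rightarrow> nat) \<Rightarrow> bool" where
  "proper V P c \<longleftrightarrow> c ` V \<subseteq> P \<and> (\<forall>u\<in>V. \<forall>v\<in>V. adj u v \<longrightarrow> c u \<noteq> c v)"

lemma proper_cong:
  assumes "\<And>v. v \<in> V \<Longrightarrow> c v = d v"
  shows "proper V P c \<longleftrightarrow> proper V P d"
  using assms by (auto simp: proper_def image_subset_iff)

lemma proper_same_color: "proper V P c \<Longrightarrow> u \<in> V \<Longrightarrow> v \<in> V \<Longrightarrow> c u = c v \<Longrightarrow> \<not> adj u v"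
  unfolding proper_def by blast

lemma proper_subset: "proper V P c \<Longrightarrow> W \<subseteq> V \<Longrightarrow> c ` W \<subseteq> Q \<Longrightarrow> proper W Q c"
  unfolding proper_def by blast

lemma proper_mono: "proper V P c \<Longrightarrow> W \<subseteq> V \<Longrightarrow> P \<subseteq> Q \<Longrightarrow> proper W Q c"
  unfolding proper_def by (meson image_mono order_trans subset_iff)

text \<open>Irreflexivity keeps \<open>v\<close> out of its own neighborhood, so the neighbors still
  have their old colors, and symmetry lets one orientation of each edge suffice. The old color of
  \<open>v\<close> is overwritten, hence \<open>V - {v}\<close>.\<close>

lemma proper_fun_upd_iff:
  assumes "v \<in> V"
  shows "proper V P (c(v := x)) \<longleftrightarrow>
    proper (V - {v}) P c \<and> x \<in> P \<and> (\<forall>u\<in>V. adj u v \<longrightarrow> c u \<noteq> x)"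
proof -
  have neq: "u \<noteq> v" if "adj u v" for u using that adj_irrefl by blast
  show ?thesis
  proof
    assume *: "proper V P (c(v := x))"
    then have "proper (V - {v}) P (c(v := x))"
      by (rule proper_subset) (use * in \<open>auto simp: proper_def\<close>)
    then have "proper (V - {v}) P c"
      using proper_cong[of "V - {v}" "c(v := x)" c] by simp
    moreover have "x \<in> P"
      using * assms by (auto simp: proper_def)
    moreover have "c u \<noteq> x" if "u \<in> V" "adj u v" for u
    proof -
      have "(c(v := x)) u \<noteq> (c(v := x)) v"
        using * assms that unfolding proper_def by blast
      then show ?thesis using neq[OF that(2)] by simp
    qed
    ultimately show "proper (V - {v}) P c \<and> x \<in> P \<and> (\<forall>u\<in>V. adj u v \<longrightarrow> c u \<noteq> x)"
      by blast
  next
    assume *: "proper (V - {v}) P c \<and> x \<in> P \<and> (\<forall>u\<in>V. adj u v \<longrightarrow> c u \<noteq> x)"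
    have "(c(v := x)) u \<noteq> (c(v := x)) w" if "u \<in> V" "w \<in> V" "adj u w" for u w
    proof -
      consider "u = v" "w \<noteq> v" | "w = v" "u \<noteq> v" | "u \<noteq> v" "w \<noteq> v"
        using \<open>adj u w\<close> adj_irrefl by metis
      then show ?thesis
      proof cases
        case 1
        then show ?thesis using * that adj_sym[OF that(3)] by auto
      next
        case 2
        then show ?thesis using * that by auto
      next
        case 3
        then have "c u \<noteq> c w" using * that unfolding proper_def by blast
        then show ?thesis using 3 by simp
      qed
    qed
    moreover have "(c(v := x)) ` V \<subseteq> P"
      using * unfolding proper_def by auto
    ultimately show "proper V P (c(v := x))"
      unfolding proper_def by blast
  qed
qed

section \<open>Recoloring walks with a count of moves per vertex\<close>

text \<open>
  The last argument counts the moves of each vertex; a move may leave the color unchanged.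
  Colors outside \<open>V\<close> are arbitrary but never change.
\<close>

inductive recol :: "'a set \<Rightarrow> nat set \<Rightarrow> ('a \<Rightarrow> nat) \<Rightarrow> ('a \<Rightarrow> nat) \<Rightarrow> ('a \<Rightarrow> nat) \<Rightarrow> bool"
  for V P where
  refl: "proper V P c \<Longrightarrow> recol V P c c (\<lambda>_. 0)"
| step: "recol V P c d m \<Longrightarrow> v \<in> V \<Longrightarrow> proper V P (d(v := x)) \<Longrightarrow>
    recol V P c (d(v := x)) (m(v := Suc (m v)))"

lemma recol_proper:
  assumes "recol V P c d m"
  shows "proper V P c" "proper V P d"
  using assms by induction auto

lemma recol_outside:
  assumes "recol V P c d m" "u \<notin> V"
  shows "d u = c u" "m u = 0"
  using assms by (induction) auto

text \<open>The induction runs over the later walk, which is why it is the first premise.\<close>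

lemma recol_trans:
  assumes "recol V P d e m'" "recol V P c d m"
  shows "recol V P c e (\<lambda>v. m v + m' v)"
  using assms
proof induction
  case (step d e m' v x)
  have "recol V P c (e(v := x)) ((\<lambda>v. m v + m' v)(v := Suc (m v + m' v)))"
    using step by (intro recol.step) auto
  moreover have "(\<lambda>v. m v + m' v)(v := Suc (m v + m' v)) = (\<lambda>w. m w + (m'(v := Suc (m' v))) w)"
    by auto
  ultimately show ?case by (simp only:)
qed auto

lemma recol_single:
  assumes "proper V P c" "v \<in> V" "proper V P (c(v := x))"
  shows "recol V P c (c(v := x)) (\<lambda>u. if u = v then 1 else 0)"
proof -
  have "((\<lambda>_. 0)(v := Suc ((\<lambda>_. 0) v))) = (\<lambda>u. if u = v then 1 else (0::nat))"
    by auto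
  then show ?thesis
    using recol.step[OF recol.refl[OF assms(1)] assms(2,3)] by simp
qed

text \<open>A move is undone by returning the old color \<open>d v\<close>, so the reversed walk has
  the same counts.\<close>

lemma recol_sym:
  assumes "recol V P c d m"
  shows "recol V P d c m"
  using assms
proof induction
  case (step c d m v x)
  have "recol V P (d(v := x)) ((d(v := x))(v := d v)) (\<lambda>u. if u = v then 1 else 0)"
    using step recol_proper(2) by (intro recol_single) auto
  then have "recol V P (d(v := x)) d (\<lambda>u. if u = v then 1 else 0)"
    by simp
  from recol_trans[OF step.IH this]
  have "recol V P (d(v := x)) c (\<lambda>u. (if u = v then 1 else 0) + m u)" .
  moreover have "(\<lambda>u. (if u = v then 1 else 0) + m u) = m(v := Suc (m v))"
    by auto
  ultimately show ?case by (simp only:)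
qed (rule recol.refl)

text \<open>The vertices of \<open>V - W\<close> stand still on colors outside \<open>Q\<close>, so
  moves within \<open>W\<close> and \<open>Q\<close> cannot conflict with them. This puts back what
  an induction has deleted.\<close>

lemma recol_extend:
  assumes "recol W Q c d m" "proper V P c" "W \<subseteq> V" "Q \<subseteq> P"
    and fresh: "\<And>u. u \<in> V - W \<Longrightarrow> c u \<notin> Q"
  shows "recol V P c d m"
  using assms
proof induction
  case (refl c)
  then show ?case by (intro recol.refl)
next
  case (step c d m v x)
  have "proper V P d"
    using step recol_proper(2) by blast
  moreover have "d u \<notin> Q" if "u \<in> V - W" for u
    using recol_outside(1)[OF step.hyps(1), of u] step.prems that by auto
  moreover have "x \<in> Q"
    using step.hyps by (auto simp: proper_def)
  moreover have "\<forall>u\<in>W. adj u v \<longrightarrow> d u \<noteq> x"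
    using step.hyps(3) proper_fun_upd_iff[OF step.hyps(2)] by blast
  moreover have "v \<in> V"
    using step.hyps(2) step.prems(2) by blast
  ultimately have "proper V P (d(v := x))"
    using proper_fun_upd_iff[of v V P d x] proper_mono[of V P d "V - {v}" P] step.prems(3)
    by blast
  then show ?case
    using step by (intro recol.step) auto
qed

text \<open>The vertices of \<open>S\<close> move one at a time. Every intermediate coloring is
  proper because \<open>s\<close> occurs only inside the independent set \<open>S\<close>.\<close>

lemma recol_same_color:
  assumes "finite S" "S \<subseteq> V" "proper V P c" "s \<in> P"
    and unused: "\<And>v. v \<in> V - S \<Longrightarrow> c v \<noteq> s"
    and indep: "\<And>u v. u \<in> S \<Longrightarrow> v \<in> S \<Longrightarrow> \<not> adj u v"
  shows "recol V P c (\<lambda>v. if v \<in> S then s else c v) (\<lambda>v. if v \<in> S then 1 else 0)"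
proof -
  have "recol V P c (\<lambda>v. if v \<in> T then s else c v) (\<lambda>v. if v \<in> T then 1 else 0)" if "T \<subseteq> S" for T
    using finite_subset[OF that assms(1)] that
  proof (induction rule: finite_induct)
    case empty
    then show ?case using assms(3) by (simp add: recol.refl)
  next
    case (insert x F)
    let ?d = "\<lambda>v. if v \<in> F then s else c v"
    let ?m = "\<lambda>v. if v \<in> F then 1 else (0::nat)"
    have eq: "?d(x := s) = (\<lambda>v. if v \<in> insert x F then s else c v)"
      "?m(x := Suc (?m x)) = (\<lambda>v. if v \<in> insert x F then 1 else 0)"
      using insert.hyps by auto
    have "recol V P c (?d(x := s)) (?m(x := Suc (?m x)))"
    proof (rule recol.step)
      show "recol V P c ?d ?m" using insert by blast
      show "x \<in> V" using insert.prems assms(2) by blast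
      have "proper V P ?d"
        using insert recol_proper(2) by blast
      moreover have "?d u \<noteq> s" if "u \<in> V" "adj u x" for u
        using that insert.prems indep[of u x] unused[of u] by auto
      ultimately show "proper V P (?d(x := s))"
        using proper_fun_upd_iff[OF \<open>x \<in> V\<close>] proper_mono[of V P ?d "V - {x}" P] assms(4) by blast
    qed
    then show ?case unfolding eq .
  qed
  then show ?thesis by blast
qed

text \<open>When \<open>N(v) \<subseteq> N(w)\<close>, the vertex \<open>v\<close> can copy every move of \<open>w\<close>.\<close>

lemma recol_follow:
  assumes "recol (V - {v}) P c d m"
    and vw: "v \<in> V" "w \<in> V" "v \<noteq> w" "\<not> adj v w"
    and dom: "\<And>u. u \<in> V \<Longrightarrow> adj u v \<Longrightarrow> adj u w"
  shows "recol V P (c(v := c w)) (d(v := d w)) (m(v := m w))"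
  using assms(1)
proof induction
  \<comment> \<open>Every neighbor of \<open>v\<close> is a neighbor of \<open>w\<close>, so the
    color of \<open>w\<close> is available at \<open>v\<close>.\<close>
  have lift: "proper V P (d(v := d w))" if "proper (V - {v}) P d" for d
  proof -
    have "d w \<in> P" and "d u \<noteq> d w" if "u \<in> V" "adj u v" for u
      using \<open>proper (V - {v}) P d\<close> vw dom[OF that] that adj_irrefl[of v]
      unfolding proper_def by blast+
    moreover have "d w \<in> P"
      using \<open>proper (V - {v}) P d\<close> vw unfolding proper_def by blast
    ultimately show ?thesis
      using \<open>proper (V - {v}) P d\<close> proper_fun_upd_iff[OF vw(1)] by blast
  qed
  {
    case (refl c)
    then have "recol V P (c(v := c w)) (c(v := c w)) (\<lambda>_. 0)"
      by (intro recol.refl lift)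
    moreover have "(\<lambda>_. 0)(v := 0) = (\<lambda>_. 0::nat)" by auto
    ultimately show ?case by (simp only:)
  next
    case (step c d m u x)
    have d: "proper V P (d(v := d w))" "proper V P (d(u := x, v := (d(u := x)) w))"
      by (rule lift[OF recol_proper(2)[OF step.hyps(1)]], rule lift[OF step.hyps(3)])
    have IH: "recol V P (c(v := c w)) (d(v := d w)) (m(v := m w))"
      by (rule step.IH)
    have "recol V P (c(v := c w)) (d(u := x, v := (d(u := x)) w))
      (m(u := Suc (m u), v := (m(u := Suc (m u))) w))"
    proof (cases "u = w")
      case False
      have eq: "d(u := x, v := (d(u := x)) w) = (d(v := d w))(u := x)"
        "m(u := Suc (m u), v := (m(u := Suc (m u))) w) = (m(v := m w))(u := Suc ((m(v := m w)) u))"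
        using step.hyps(2) False by auto
      show ?thesis
        unfolding eq using IH _ d(2)[unfolded eq] by (rule recol.step) (use step.hyps(2) in simp)
    next
      case True
      \<comment> \<open>\<open>w\<close> moves first and \<open>v\<close> follows. \<open>?e\<close>
        is the coloring in between, where \<open>v\<close> still has the old color
        \<open>d w\<close>; it is proper since \<open>w\<close> is not a neighbor of
        \<open>v\<close>.\<close>
      let ?e = "(d(v := d w))(w := x)" and ?n = "(m(v := m w))(w := Suc (m w))"
      have e: "proper V P ?e"
      proof -
        have "d u' \<noteq> d w" if "u' \<in> V" "adj u' v" for u'
          using d(1) that proper_fun_upd_iff[OF vw(1), of P d "d w"] by blast
        moreover have "d w \<in> P"
          using d(1) proper_fun_upd_iff[OF vw(1), of P d "d w"] by blast
        moreover have "u' \<noteq> w" if "adj u' v" for u'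
          using that vw(4) adj_sym by blast
        ultimately have "proper V P (d(w := x, v := d w))"
          using proper_fun_upd_iff[OF vw(1), of P "d(w := x)" "d w"] step.hyps(3) True by auto
        then show ?thesis
          using vw(3) by (simp add: fun_upd_twist)
      qed
      have "recol V P (c(v := c w)) ?e ((m(v := m w))(w := Suc ((m(v := m w)) w)))"
        using IH vw(2) e by (rule recol.step)
      then have *: "recol V P (c(v := c w)) ?e ?n" using vw(3) by simp
      have eq: "d(u := x, v := (d(u := x)) w) = ?e(v := x)"
        "m(u := Suc (m u), v := (m(u := Suc (m u))) w) = ?n(v := Suc (?n v))"
        using vw(3) True by auto
      show ?thesis
        unfolding eq using * vw(1) d(2)[unfolded eq] by (rule recol.step)
    qed
    then show ?case .
  }
qed

section \<open>Graphs without independent triples\<close>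

definition triple_free :: "'a set \<Rightarrow> bool" where
  "triple_free V \<longleftrightarrow> (\<forall>a\<in>V. \<forall>b\<in>V. \<forall>c\<in>V. a \<noteq> b \<longrightarrow> b \<noteq> c \<longrightarrow> a \<noteq> c \<longrightarrow>
    adj a b \<or> adj b c \<or> adj a c)"

lemma triple_free_subset: "triple_free V \<Longrightarrow> W \<subseteq> V \<Longrightarrow> triple_free W"
  unfolding triple_free_def by blast

text \<open>A third vertex of the same color would complete an independent triple.\<close>

lemma proper_class_of_pair:
  assumes "triple_free V" "proper V P c" "u \<in> V" "v \<in> V" "w \<in> V"
    and "u \<noteq> v" "c u = c v" "c w = c v"
  shows "w = u \<or> w = v"
  using assms unfolding triple_free_def proper_def by metis

text \<open>Double counting: classes of \<open>c\<close> have at most two vertices, so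
  \<open>card V\<close> is at most twice the number of its colors. If all classes of
  \<open>d\<close> had at least two, \<open>card V\<close> would be at least twice the larger number
  of colors of \<open>d\<close>.\<close>

lemma exists_singleton_class:
  fixes d :: "'a \<Rightarrow> nat"
  assumes "finite V" "triple_free V" "proper V P c" "card (c ` V) < card (d ` V)"
  shows "\<exists>v\<in>V. \<forall>u\<in>V. d u = d v \<longrightarrow> u = v"
proof (rule ccontr)
  assume "\<not> ?thesis"
  then have neg: "\<exists>u\<in>V. d u = d v \<and> u \<noteq> v" if "v \<in> V" for v
    using that by blast
  have card_eq: "card V = (\<Sum>y\<in>f ` V. card {x\<in>V. f x = y})" for f :: "'a \<Rightarrow> nat"
    using sum.image_gen[OF assms(1), of "\<lambda>_. 1::nat" f] by simp
  have le: "card {x\<in>V. c x = y} \<le> 2" for y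
  proof (rule ccontr)
    assume "\<not> ?thesis"
    then have "3 \<le> card {x\<in>V. c x = y}" by simp
    then obtain T where "T \<subseteq> {x\<in>V. c x = y}" "card T = 3"
      by (meson obtain_subset_with_card_n)
    then obtain a b e where "T = {a, b, e}" "a \<noteq> b" "b \<noteq> e" "a \<noteq> e"
      by (auto simp: card_3_iff)
    then show False
      using proper_class_of_pair[OF assms(2,3), of a b e] \<open>T \<subseteq> _\<close> by auto
  qed
  have ge: "2 \<le> card {x\<in>V. d x = y}" if "y \<in> d ` V" for y
  proof -
    obtain v where v: "v \<in> V" "d v = y" using \<open>y \<in> d ` V\<close> by blast
    obtain u where u: "u \<in> V" "d u = y" "u \<noteq> v" using neg[OF v(1)] v(2) by blast
    have "{u, v} \<subseteq> {x\<in>V. d x = y}" using u v by auto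
    then have "card {u, v} \<le> card {x\<in>V. d x = y}"
      using assms(1) by (intro card_mono) auto
    then show ?thesis using u by simp
  qed
  have "card (d ` V) * 2 \<le> card V"
    unfolding card_eq[of d] using sum_bounded_below[of "d ` V" 2 "\<lambda>y. card {x\<in>V. d x = y}"] ge by auto
  moreover have "card V \<le> card (c ` V) * 2"
    unfolding card_eq[of c] using sum_bounded_above[of "c ` V" "\<lambda>y. card {x\<in>V. c x = y}" 2] le by auto
  ultimately show False using assms(4) by simp
qed

text \<open>
  In the complement, the color classes form matchings, and this walks along an augmenting path:
  \<open>v\<close> is its first vertex, and the mate \<open>w\<close> of \<open>v\<close> under \<open>c\<close> moves to the class of \<open>v\<close>.
\<close>

lemma recol_drop_color:
  assumes "finite V" "triple_free V" "proper V Q c" "proper V P d" "card (c ` V) < card (d ` V)"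
  shows "\<exists>e m. recol V (d ` V) d e m \<and> e ` V \<subset> d ` V \<and> (\<forall>v. m v \<le> 1)"
  using assms
proof (induction "card V" arbitrary: V d rule: less_induct)
  case less
  have drop_one: "card (f ` V - {f v}) < card (g ` V - {g v})"
    if "card (f ` V) < card (g ` V)" "v \<in> V" for f g :: "'a \<Rightarrow> nat" and v
  proof -
    \<comment> \<open>Subtraction is truncated: for an empty image the strict inequality could be
      lost.\<close>
    have "card (f ` V) \<noteq> 0" using less.prems(1) that(2) by auto
    then show ?thesis using that by (simp add: card_Diff_singleton)
  qed
  obtain v where v: "v \<in> V" and single: "\<And>u. u \<in> V \<Longrightarrow> d u = d v \<Longrightarrow> u = v"
    using exists_singleton_class[OF less.prems(1-3,5)] by blast
  have proper_d: "proper V (d ` V) d"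
    using less.prems(4) by (auto simp: proper_def)
  have smaller: "card W < card V" "finite W" "triple_free W" "proper W Q c" "proper W P d"
    if "W \<subset> V" for W
  proof -
    have "W \<subseteq> V" using that by (rule psubset_imp_subset)
    then show "card W < card V" "finite W" "triple_free W" "proper W Q c" "proper W P d"
      using psubset_card_mono[OF less.prems(1) that] finite_subset[OF _ less.prems(1), of W]
        triple_free_subset[OF less.prems(2), of W] proper_mono[OF less.prems(3), of W Q]
        proper_mono[OF less.prems(4), of W P] by simp_all
  qed
  show ?case
  proof (cases "\<exists>w\<in>V. w \<noteq> v \<and> c w = c v")
    case False
    \<comment> \<open>\<open>v\<close> is alone in its class under both colorings, so deleting it
      costs each of them exactly one color.\<close>
    let ?W = "V - {v}"
    have imd: "d ` ?W = d ` V - {d v}"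
    proof -
      have "d u \<noteq> d v" if "u \<in> ?W" for u using that single by blast
      then show ?thesis by (auto simp del: Diff_iff)
    qed
    have imc: "c ` ?W = c ` V - {c v}" using v False by (auto simp: image_iff)
    have cards: "card (c ` ?W) < card (d ` ?W)"
      unfolding imd imc using drop_one[of c d] less.prems(1,5) v by blast
    have "?W \<subset> V" using v by auto
    from less.hyps[OF smaller[OF this] cards]
    obtain e m where em: "recol ?W (d ` ?W) d e m" "e ` ?W \<subset> d ` ?W" "\<forall>v. m v \<le> 1"
      by (elim exE conjE)
    have em': "recol V (d ` V) d e m"
      using em(1)[unfolded imd] proper_d by (rule recol_extend) auto
    have "e ` V = insert (e v) (e ` ?W)"
      using v by (metis image_insert insert_Diff)
    then have "e ` V = insert (d v) (e ` ?W)"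
      using recol_outside(1)[OF em(1), of v] by simp
    then have "e ` V \<subset> d ` V"
      using insert_psubset[OF em(2)[unfolded imd]] v by simp
    then show ?thesis using em' em(3) by blast
  next
    case True
    then obtain w where w: "w \<in> V" "w \<noteq> v" "c w = c v" by blast
    let ?e = "d(w := d v)"
    have proper_e: "proper W P ?e" if "w \<notin> W" "proper W P d" for W
      using proper_cong[of W ?e d P] that by (metis fun_upd_other)
    have nadj: "\<not> adj w v" "\<not> adj v w"
      using w v less.prems(3) unfolding proper_def by metis+
    have prop_e: "proper V (d ` V) ?e"
      using proper_d proper_fun_upd_iff[OF w(1)] proper_mono[OF proper_d, of "V - {w}"] v single nadj
      by blast
    have one: "recol V (d ` V) d ?e (\<lambda>u. if u = w then 1 else 0)"
      using proper_d w(1) prop_e by (rule recol_single)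
    show ?thesis
    proof (cases "\<exists>x\<in>V. x \<noteq> w \<and> d x = d w")
      \<comment> \<open>The path ends here: \<open>w\<close> was alone on \<open>d w\<close>, so its
        move makes that color disappear.\<close>
      case False
      have "d w \<noteq> d v" using single w by blast
      then have "d w \<notin> ?e ` V" using False by (auto split: if_splits)
      moreover have "?e ` V \<subseteq> d ` V" using v by auto
      ultimately have "?e ` V \<subset> d ` V" using w(1) by blast
      moreover have "\<forall>u. (if u = w then 1 else 0) \<le> (1::nat)" by simp
      ultimately show ?thesis using one by blast
    next
      case True
      then obtain x where x: "x \<in> V" "x \<noteq> w" "d x = d w" by blast
      \<comment> \<open>After the move, \<open>{v, w}\<close> is a full class of both
        \<open>c\<close> and \<open>?e\<close> and is deleted with its color. The vertex
        \<open>x\<close> keeps \<open>d w\<close> in use, so \<open>?e\<close> also loses just one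
        color.\<close>
      let ?W = "V - {v, w}"
      have xv: "x \<noteq> v" using x(3) single[OF w(1)] w(2) by auto
      have imd: "d ` ?W = d ` V - {d v}"
      proof -
        have "d x \<in> d ` ?W" using x xv by blast
        moreover have "d y \<noteq> d v" if "y \<in> ?W" for y using that single by blast
        moreover have "d w \<in> d ` ?W" using x xv by (metis Diff_iff empty_iff image_eqI insert_iff)
        moreover have "d y \<in> d ` ?W \<or> d y = d v" if "y \<in> V" for y
          using calculation(3) that by blast
        ultimately show ?thesis by auto
      qed
      have ime: "?e ` ?W = d ` ?W" by auto
      have imc: "c ` ?W = c ` V - {c v}"
        using v w proper_class_of_pair[OF less.prems(2,3), of v w] by auto
      have cards: "card (c ` ?W) < card (?e ` ?W)"
        unfolding ime imd imc using drop_one[of c d] less.prems(1,5) v by blast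
      have W: "?W \<subset> V" using v by auto
      have eW: "proper ?W P ?e" using proper_e[OF _ smaller(5)[OF W]] by simp
      from less.hyps[OF smaller(1-4)[OF W] eW cards]
      obtain f m where fm: "recol ?W (d ` ?W) ?e f m" "f ` ?W \<subset> d ` ?W" "\<forall>v. m v \<le> 1"
        unfolding ime by (elim exE conjE)
      have "recol V (d ` V) ?e f m"
        using fm(1)[unfolded imd] prop_e by (rule recol_extend) auto
      from recol_trans[OF this one]
      have df: "recol V (d ` V) d f (\<lambda>u. (if u = w then 1 else 0) + m u)" .
      have "f v = d v" "f w = d v"
        using recol_outside(1)[OF fm(1), of v] recol_outside(1)[OF fm(1), of w] w(2) by auto
      moreover have "V = insert v (insert w ?W)"
        using v w(1) by auto
      then have "f ` V = insert (f v) (insert (f w) (f ` ?W))"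
        by (metis image_insert)
      ultimately have "f ` V = insert (d v) (f ` ?W)"
        by simp
      then have "f ` V \<subset> d ` V"
        using insert_psubset[OF fm(2)[unfolded imd]] v by simp
      \<comment> \<open>\<open>w\<close> was deleted before the recursive walk, so it does not move
        a second time.\<close>
      moreover have "(if u = w then 1 else 0) + m u \<le> 1" for u
        using recol_outside(2)[OF fm(1), of w] fm(3) by auto
      ultimately show ?thesis using df by blast
    qed
  qed
qed

text \<open>Deleting a class \<open>C\<close> of \<open>d\<close> lowers the bound by
  \<open>card C\<close>. This pays for at most \<open>card C - 1\<close> moves per vertex to free a
  color, and one move either to clear \<open>t\<close> or to install \<open>C\<close>. The rest of
  \<open>d\<close> remains optimal, and the palette loses only \<open>t\<close>.\<close>

lemma recol_to_optimal:
  assumes "finite V" "triple_free V" "finite P" "proper V P c" "proper V P d"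
    and "\<And>v. v \<notin> V \<Longrightarrow> c v = d v"
    and "card (d ` V) < card P"
    and "\<And>e. proper V UNIV e \<Longrightarrow> card (d ` V) \<le> card (e ` V)"
  shows "\<exists>m. recol V P c d m \<and> (\<forall>v. m v \<le> card V)"
  using assms
proof (induction "card V" arbitrary: V P c rule: less_induct)
  case less
  note fin = less.prems(1) and tf = less.prems(2) and finP = less.prems(3)
    and c = less.prems(4) and d = less.prems(5) and outside = less.prems(6)
    and small = less.prems(7) and opt = less.prems(8)
  show ?case
  proof (cases "V = {}")
    case True
    then have "c = d" using outside by auto
    then show ?thesis using recol.refl[OF c] by auto
  next
    case False
    \<comment> \<open>A class of two vertices is taken whenever \<open>d\<close> has one; a
      singleton is taken only if \<open>d\<close> is injective.\<close>
    obtain C t where C: "C = {v\<in>V. d v = t}" and cardC: "card C = 2 \<or> card C = 1 \<and> inj_on d V"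
    proof (cases "inj_on d V")
      case True
      obtain v where "v \<in> V" using False by blast
      then have "{u\<in>V. d u = d v} = {v}" using True by (auto dest: inj_onD)
      then show ?thesis using that[of "{u\<in>V. d u = d v}" "d v"] True by simp
    next
      case False
      then obtain u v where uv: "u \<in> V" "v \<in> V" "u \<noteq> v" "d u = d v"
        unfolding inj_on_def by blast
      then have "{w\<in>V. d w = d v} = {u, v}"
        using proper_class_of_pair[OF tf d, of u v] by auto
      then show ?thesis using that[of "{w\<in>V. d w = d v}" "d v"] uv(3) by simp
    qed
    have CV: "C \<subseteq> V" using C by blast
    have "C \<noteq> {}" using cardC by auto
    then have t: "t \<in> P" "t \<in> d ` V" using C d unfolding proper_def by auto
    have "\<exists>c' m s. recol V P c c' m \<and> s \<in> P \<and> s \<notin> c' ` V \<and> (\<forall>v. m v \<le> card C - 1)"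
    proof (cases "c ` V = P")
      case False
      then obtain s where "s \<in> P" "s \<notin> c ` V" using c unfolding proper_def by blast
      then show ?thesis using recol.refl[OF c] by (intro exI conjI) auto
    next
      case True
      \<comment> \<open>Otherwise \<open>card P = card (c\<close> V) \<le> card V = card (d
        \<open>V)\<close>, against \<open>small\<close>.\<close>
      have "\<not> inj_on d V"
        using card_image[of d V] card_image_le[OF fin, of c] small True by auto
      then have "card C = 2" using cardC by blast
      \<comment> \<open>The roles are exchanged: \<open>c\<close> uses all of \<open>P\<close>,
        hence more colors than \<open>d\<close>, and gives one up.\<close>
      moreover from recol_drop_color[OF fin tf d c small[folded True], unfolded True]
      obtain e m where em: "recol V P c e m" "e ` V \<subset> P" "\<forall>v. m v \<le> 1"
        by (elim exE conjE)
      moreover obtain s where "s \<in> P" "s \<notin> e ` V" using em(2) by blast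
      moreover from \<open>card C = 2\<close> em(3) have "\<forall>v. m v \<le> card C - 1" by simp
      ultimately show ?thesis by metis
    qed
    then obtain c1 m1 s where c1: "recol V P c c1 m1" and s: "s \<in> P" "s \<notin> c1 ` V"
      and m1: "\<forall>v. m1 v \<le> card C - 1" by (elim exE conjE)
    \<comment> \<open>\<open>T\<close> evades to the free color \<open>s\<close>, and then
      \<open>C\<close> takes \<open>t\<close>. If \<open>s = t\<close>, the set \<open>T\<close> is
      empty.\<close>
    define T where "T = {v\<in>V - C. c1 v = t}"
    define c2 where "c2 = (\<lambda>v. if v \<in> T then s else c1 v)"
    define c3 where "c3 = (\<lambda>v. if v \<in> C then t else c2 v)"
    have c2: "recol V P c1 c2 (\<lambda>v. if v \<in> T then 1 else 0)"
      unfolding c2_def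
    proof (rule recol_same_color)
      show "finite T" "T \<subseteq> V" using fin unfolding T_def by auto
      show "proper V P c1" using c1 by (rule recol_proper)
      then show "\<not> adj u v" if "u \<in> T" "v \<in> T" for u v
        using that proper_same_color[of V P c1 u v] unfolding T_def by simp
    qed (use s in auto)
    have free: "c2 v \<noteq> t" if "v \<in> V - C" for v
      using that s unfolding c2_def T_def by auto
    have c3: "recol V P c2 c3 (\<lambda>v. if v \<in> C then 1 else 0)"
      unfolding c3_def
    proof (rule recol_same_color)
      show "finite C" using fin CV by (rule rev_finite_subset)
      show "proper V P c2" using c2 by (rule recol_proper)
      show "\<not> adj u v" if "u \<in> C" "v \<in> C" for u v
        using that proper_same_color[OF d, of u v] unfolding C by simp
    qed (use CV t free in auto)
    let ?W = "V - C" and ?Q = "P - {t}"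
    have imd: "d ` ?W = d ` V - {t}" unfolding C by auto
    have cardim: "card (d ` ?W) = card (d ` V) - 1"
      unfolding imd using t by (simp add: card_Diff_singleton)
    have pos: "card (d ` V) \<noteq> 0" using fin t by auto
    have W: "card ?W = card V - card C" "card C \<le> card V"
      using card_Diff_subset[OF finite_subset[OF CV fin] CV] card_mono[OF fin CV] by auto
    have c3proper: "proper V P c3" using c3 by (rule recol_proper)
    have "\<exists>m. recol ?W ?Q c3 d m \<and> (\<forall>v. m v \<le> card ?W)"
    proof (rule less.hyps)
      show "card ?W < card V" using W cardC by auto
      show "finite ?W" "finite ?Q" using fin finP by auto
      show "triple_free ?W" using tf by (rule triple_free_subset) blast
      have "c3 v \<in> ?Q" if "v \<in> ?W" for v
        using that free c3proper unfolding c3_def proper_def by auto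
      then show "proper ?W ?Q c3"
        using c3proper by (intro proper_subset[OF c3proper]) auto
      show "proper ?W ?Q d"
        using d by (rule proper_subset) (use d C in \<open>auto simp: proper_def\<close>)
      show "c3 v = d v" if "v \<notin> ?W" for v
      proof (cases "v \<in> C")
        case True
        then show ?thesis unfolding c3_def C by simp
      next
        case False
        then have "v \<notin> V" using that by blast
        then show ?thesis
          using False recol_outside(1)[OF c1, of v] outside[of v] unfolding c3_def c2_def T_def by simp
      qed
      show "card (d ` ?W) < card ?Q"
        using cardim pos small t finP by (simp add: card_Diff_singleton)
      show "card (d ` ?W) \<le> card (e ` ?W)" if e: "proper ?W UNIV e" for e
      proof -
        \<comment> \<open>With a fresh color \<open>r\<close> on the independent set
          \<open>C\<close>, a better coloring of the rest would beat \<open>d\<close> on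
          \<open>V\<close>.\<close>
        obtain r where r: "r \<notin> e ` ?W"
          using ex_new_if_finite[OF infinite_UNIV_nat, of "e ` ?W"] fin by auto
        let ?e = "\<lambda>v. if v \<in> C then r else e v"
        have "\<not> adj u v" if "u \<in> C" "v \<in> C" for u v
          using that proper_same_color[OF d, of u v] unfolding C by simp
        moreover have "e u \<noteq> e v" if "u \<in> ?W" "v \<in> ?W" "adj u v" for u v
          using that proper_same_color[OF e, of u v] by blast
        moreover have "e u \<noteq> r" if "u \<in> ?W" for u
          using r that by auto
        ultimately have "?e u \<noteq> ?e v" if "u \<in> V" "v \<in> V" "adj u v" for u v
          using that by (metis DiffI)
        then have "proper V UNIV ?e"
          unfolding proper_def by blast
        then have "card (d ` V) \<le> card (?e ` V)" by (rule opt)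
        also have "?e ` V \<subseteq> insert r (e ` ?W)" by auto
        then have "card (?e ` V) \<le> card (insert r (e ` ?W))"
          using fin by (intro card_mono) auto
        also have "\<dots> = Suc (card (e ` ?W))" using r fin by simp
        finally show ?thesis using cardim by simp
      qed
    qed
    then obtain m4 where m4: "recol ?W ?Q c3 d m4" "\<forall>v. m4 v \<le> card ?W"
      by (elim exE conjE)
    have "recol V P c3 d m4"
      using m4(1) c3proper by (rule recol_extend) (auto simp: c3_def)
    from recol_trans[OF recol_trans[OF recol_trans[OF this c3] c2] c1]
    have "recol V P c d (\<lambda>v. m1 v + ((if v \<in> T then 1 else 0) + ((if v \<in> C then 1 else 0) + m4 v)))" .
    moreover have "m1 v + ((if v \<in> T then 1 else 0) + ((if v \<in> C then 1 else 0) + m4 v)) \<le> card V" for v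
    proof -
      \<comment> \<open>So the total is at most
        \<open>(card C - 1) + 1 + (card V - card C)\<close>.\<close>
      have "v \<notin> T \<or> v \<notin> C" unfolding T_def by blast
      then show ?thesis using spec[OF m1, of v] spec[OF m4(2), of v] W cardC by auto
    qed
    ultimately show ?thesis by blast
  qed
qed

section \<open>Comparable vertices from the forbidden subgraphs\<close>

definition two_K2_free :: "'a set \<Rightarrow> bool" where
  "two_K2_free V \<longleftrightarrow> (\<forall>a\<in>V. \<forall>b\<in>V. \<forall>c\<in>V. \<forall>d\<in>V. adj a b \<longrightarrow> adj c d \<longrightarrow>
    adj a c \<or> adj a d \<or> adj b c \<or> adj b d)"

definition claw_free :: "'a set \<Rightarrow> bool" where
  "claw_free V \<longleftrightarrow> (\<forall>v\<in>V. \<forall>a\<in>V. \<forall>b\<in>V. \<forall>c\<in>V. adj v a \<longrightarrow> adj v b \<longrightarrow> adj v c \<longrightarrow>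
    a \<noteq> b \<longrightarrow> b \<noteq> c \<longrightarrow> a \<noteq> c \<longrightarrow> adj a b \<or> adj b c \<or> adj a c)"

text \<open>
  In an independent triple \<open>a, b, c\<close>, the vertex \<open>a\<close> is dominated by any \<open>x\<close> adjacent to \<open>b\<close> and \<open>c\<close>
  only. If no vertex has exactly two neighbors in the triple, \<open>a\<close> is dominated by any neighbor of \<open>b\<close>.
\<close>

lemma exists_comparable_pair:
  assumes "two_K2_free V" "claw_free V" "\<not> triple_free V"
  shows "\<exists>v\<in>V. \<exists>w\<in>V. v \<noteq> w \<and> \<not> adj v w \<and> (\<forall>u\<in>V. adj u v \<longrightarrow> adj u w)"
proof -
  define indep where "indep = (\<lambda>a b c. a \<in> V \<and> b \<in> V \<and> c \<in> V \<and> a \<noteq> b \<and> b \<noteq> c \<and> a \<noteq> c \<and>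
    \<not> adj a b \<and> \<not> adj b c \<and> \<not> adj a c)"
  obtain a b c where abc: "indep a b c"
    using assms(3) unfolding triple_free_def indep_def by blast
  have rot: "indep b c a" "indep c a b"
    using abc adj_sym unfolding indep_def by blast+
  have claw: "\<not> (adj v a \<and> adj v b \<and> adj v c)" if "v \<in> V" "indep a b c" for v a b c
    using that assms(2) unfolding claw_free_def indep_def by blast
  \<comment> \<open>The edges \<open>u a\<close> and \<open>x b\<close> must be joined, and
    \<open>u x\<close> is the only pair left.\<close>
  have cross: "adj u x" if "u \<in> V" "x \<in> V" "a \<in> V" "b \<in> V" "adj u a" "adj x b" "\<not> adj u b" "\<not> adj x a" "\<not> adj a b"
    for u x a b
    using that assms(1) adj_sym unfolding two_K2_free_def by blast
  have two: ?thesis if "indep a b c" "x \<in> V" "adj x b" "adj x c" "\<not> adj x a" for a b c x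
  proof -
    have "adj u x" if u: "u \<in> V" "adj u a" for u
    proof (rule ccontr)
      assume "\<not> adj u x"
      \<comment> \<open>Applying \<open>cross\<close> against \<open>b\<close> and against
        \<open>c\<close> makes \<open>u\<close> the center of a claw.\<close>
      then have "adj u b" "adj u c"
        using cross[of u x a b] cross[of u x a c] u that \<open>indep a b c\<close> \<open>x \<in> V\<close> \<open>adj x b\<close> \<open>adj x c\<close> \<open>\<not> adj x a\<close>
        unfolding indep_def by blast+
      then show False using claw[OF u(1) \<open>indep a b c\<close>] u(2) by blast
    qed
    moreover have "a \<noteq> x" "\<not> adj a x"
      using that adj_sym unfolding indep_def by blast+
    ultimately show ?thesis using that(1,2) unfolding indep_def by blast
  qed
  show ?thesis
  proof (rule ccontr)
    assume neg: "\<not> ?thesis"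
    \<comment> \<open>A common neighbor of \<open>a\<close> and \<open>b\<close> either misses
      \<open>c\<close>, which \<open>two\<close> excludes, or is the center of a claw.\<close>
    have one: "\<not> adj x a" if "x \<in> V" "adj x b" for x
      using two[OF rot(2) that(1)] two[OF rot(1) that(1)] claw[OF that(1) abc] that(2) neg by blast
    \<comment> \<open>If \<open>b\<close> had no neighbor, it would be dominated by \<open>a\<close>
      trivially.\<close>
    obtain x where x: "x \<in> V" "adj x b"
      using neg abc adj_sym unfolding indep_def by blast
    have "adj u x" if "u \<in> V" "adj u a" for u
      using cross[OF that(1) x(1), of a b] that x one abc unfolding indep_def by blast
    moreover have "a \<noteq> x" "\<not> adj a x"
      using x one[OF x] abc adj_sym unfolding indep_def by blast+
    ultimately show False
      using neg x(1) abc unfolding indep_def by blast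
  qed
qed

text \<open>The coloring \<open>g\<close> witnesses that fewer than \<open>card P\<close> colors
  suffice, a condition that passes directly to \<open>V - {v}\<close> in the induction.\<close>

lemma recol_between:
  assumes "finite V" "two_K2_free V" "claw_free V" "proper V P c" "proper V P d"
    and "\<And>v. v \<notin> V \<Longrightarrow> c v = d v"
    and "proper V UNIV g" "card (g ` V) < card P"
  shows "\<exists>m. recol V P c d m \<and> (\<forall>v. m v \<le> 2 * card V)"
  using assms
proof (induction "card V" arbitrary: V c d rule: less_induct)
  case less
  note fin = less.prems(1) and c = less.prems(4) and d = less.prems(5)
    and outside = less.prems(6) and g = less.prems(7) and small = less.prems(8)
  \<comment> \<open>Infinite sets have cardinality 0, so \<open>small\<close> forces
    finiteness.\<close>
  have finP: "finite P" using small card_ge_0_finite by force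
  show ?case
  proof (cases "triple_free V")
    case True
    obtain h where h: "proper V UNIV h" and opt: "\<And>e. proper V UNIV e \<Longrightarrow> card (h ` V) \<le> card (e ` V)"
      using ex_has_least_nat[of "proper V UNIV" g "\<lambda>e. card (e ` V)"] g by blast
    have hP: "card (h ` V) < card P" using opt[OF g] small by simp
    then obtain f where f: "f ` h ` V \<subseteq> P" "inj_on f (h ` V)"
      using card_le_inj[of "h ` V" P] fin finP by auto
    \<comment> \<open>The optimal coloring \<open>h\<close> is carried into \<open>P\<close> by
      \<open>f\<close>. Outside \<open>V\<close> it copies \<open>c\<close>, and thus
      \<open>d\<close>, so that walks from both can end at \<open>k\<close>.\<close>
    define k where "k = (\<lambda>v. if v \<in> V then f (h v) else c v)"
    have imk: "k ` V = f ` h ` V" unfolding k_def by auto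
    have k: "proper V P k"
      unfolding proper_def
    proof (intro conjI ballI impI)
      show "k ` V \<subseteq> P" using f(1) imk by simp
      fix u v assume uv: "u \<in> V" "v \<in> V" "adj u v"
      then have "h u \<noteq> h v" using h unfolding proper_def by blast
      then show "k u \<noteq> k v" using uv f(2) unfolding k_def by (auto dest: inj_onD)
    qed
    have cardk: "card (k ` V) = card (h ` V)" unfolding imk using f(2) by (rule card_image)
    obtain m where m: "recol V P c k m" "\<forall>v. m v \<le> card V"
      using recol_to_optimal[OF fin True finP c k] cardk hP opt unfolding k_def by auto
    obtain m' where m': "recol V P d k m'" "\<forall>v. m' v \<le> card V"
      using recol_to_optimal[OF fin True finP d k] cardk hP opt outside unfolding k_def by auto
    have "recol V P c d (\<lambda>v. m v + m' v)"
      using recol_trans[OF recol_sym[OF m'(1)] m(1)] .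
    moreover have "m v + m' v \<le> 2 * card V" for v
      using m(2) m'(2) by (metis add_mono mult_2)
    ultimately show ?thesis by blast
  next
    case False
    then obtain v w where vw: "v \<in> V" "w \<in> V" "v \<noteq> w" "\<not> adj v w"
      and dom: "\<And>u. u \<in> V \<Longrightarrow> adj u v \<Longrightarrow> adj u w"
      using exists_comparable_pair[OF less.prems(2,3)] by blast
    \<comment> \<open>A walk on \<open>V - {v}\<close> never changes \<open>v\<close>, so its target
      must agree with \<open>c\<close> there.\<close>
    let ?W = "V - {v}" and ?d = "d(v := c v)"
    have card: "card V = Suc (card ?W)" using card_Suc_Diff1[OF fin vw(1)] by simp
    have dW: "proper ?W P ?d"
    proof -
      have "proper ?W P d" by (rule proper_mono[OF d]) auto
      then show ?thesis by (subst proper_cong[of _ _ d]) auto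
    qed
    have "\<exists>m. recol ?W P c ?d m \<and> (\<forall>u. m u \<le> 2 * card ?W)"
    proof (rule less.hyps)
      show "two_K2_free ?W" "claw_free ?W"
        using less.prems(2,3) unfolding two_K2_free_def claw_free_def by blast+
      show "proper ?W P c" "proper ?W UNIV g"
        by (rule proper_mono[OF c], auto) (rule proper_mono[OF g], auto)
      have "card (g ` ?W) \<le> card (g ` V)" using fin by (intro card_mono) auto
      then show "card (g ` ?W) < card P" using small by simp
    qed (use fin card dW outside in auto)
    then obtain m where m: "recol ?W P c ?d m" "\<forall>u. m u \<le> 2 * card ?W" by (elim exE conjE)
    let ?c' = "c(v := c w)" and ?d' = "?d(v := ?d w)" and ?m = "m(v := m w)"
    have mid: "recol V P ?c' ?d' ?m"
      using recol_follow[OF m(1) vw] dom by blast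
    have "?d' = d(v := d w)" using vw(3) by simp
    then have d': "recol V P d ?d' (\<lambda>u. if u = v then 1 else 0)"
      using recol_single[OF d vw(1)] recol_proper(2)[OF mid] by simp
    have c': "recol V P c ?c' (\<lambda>u. if u = v then 1 else 0)"
      using recol_single[OF c vw(1)] recol_proper(1)[OF mid] by blast
    from recol_trans[OF recol_trans[OF recol_sym[OF d'] mid] c']
    have "recol V P c d (\<lambda>u. (if u = v then 1 else 0) + (?m u + (if u = v then 1 else 0)))" .
    \<comment> \<open>For \<open>v\<close> this is \<open>m w + 2\<close>, within the bound because
      \<open>card V\<close> exceeds \<open>card ?W\<close> by one.\<close>
    moreover have "(if u = v then 1 else 0) + (?m u + (if u = v then 1 else 0)) \<le> 2 * card V" for u
      using spec[OF m(2), of u] spec[OF m(2), of w] card by auto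
    ultimately show ?thesis by blast
  qed
qed

end

section \<open>Forbidden induced subgraphs as conditions on adjacency\<close>

lemma induced_free_no_embedding:
  assumes "pair_wf_digraph G" "pair_wf_digraph H" "induced_free H G"
    and "inj_on f (pverts H)" "f ` pverts H \<subseteq> pverts G"
    and arcs: "\<And>u v. u \<in> pverts H \<Longrightarrow> v \<in> pverts H \<Longrightarrow> (u, v) \<in> parcs H \<longleftrightarrow> (f u, f v) \<in> parcs G"
  shows False
proof -
  interpret G: pair_wf_digraph G by fact
  interpret H: pair_wf_digraph H by fact
  \<comment> \<open>\<open>K\<close> is the image of \<open>H\<close>; it is induced because
    \<open>f\<close> also reflects arcs.\<close>
  define K where "K = \<lparr>pverts = f ` pverts H, parcs = map_prod f f ` parcs H\<rparr>"
  have parcs_K: "parcs K = {e \<in> parcs G. fst e \<in> pverts K \<and> snd e \<in> pverts K}"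
  proof (intro set_eqI iffI)
    fix e
    assume "e \<in> parcs K"
    then obtain u v where "e = (f u, f v)" "(u, v) \<in> parcs H"
      by (auto simp: K_def)
    then show "e \<in> {e \<in> parcs G. fst e \<in> pverts K \<and> snd e \<in> pverts K}"
      using H.in_arcsD1[of u v] H.in_arcsD2[of u v] arcs[of u v] by (simp add: K_def)
  next
    fix e
    assume "e \<in> {e \<in> parcs G. fst e \<in> pverts K \<and> snd e \<in> pverts K}"
    then obtain u v where "u \<in> pverts H" "v \<in> pverts H" "e = (f u, f v)" "e \<in> parcs G"
      by (cases e) (auto simp: K_def)
    then have "(u, v) \<in> parcs H" "e = map_prod f f (u, v)"
      using arcs[of u v] by simp_all
    then show "e \<in> parcs K"
      unfolding K_def by (simp del: map_prod_simp)
  qed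
  interpret K: pair_wf_digraph K
    by unfold_locales (auto simp: parcs_K)
  have "induced_subgraph (with_proj K) (with_proj G)"
    unfolding induced_subgraph_def subgraph_def
    using assms(5) parcs_K G.wf_digraph_axioms K.wf_digraph_axioms by (auto simp: K_def)
  moreover have "digraph_iso (with_proj H) (with_proj K)"
    unfolding digraph_iso_def
  proof (intro exI conjI)
    let ?h = "\<lparr>iso_verts = f, iso_arcs = map_prod f f, iso_head = snd, iso_tail = fst\<rparr>"
    have "inj_on (map_prod f f) (parcs H)"
      using assms(4) H.in_arcsD1 H.in_arcsD2 by (auto simp: inj_on_def)
    then show "pre_digraph.digraph_isomorphism (with_proj H) ?h"
      unfolding pre_digraph.digraph_isomorphism_def using assms(4) H.wf_digraph_axioms by auto
    show "with_proj K = app_iso ?h (with_proj H)"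
      by (simp add: app_iso_def with_proj_def K_def)
  qed
  ultimately show False
    using assms(3) unfolding induced_free_def by blast
qed

context pair_graph
begin

abbreviation edge :: "'a \<Rightarrow> 'a \<Rightarrow> bool" where
  "edge u v \<equiv> (u, v) \<in> parcs G"

lemma edge_sym: "edge u v \<Longrightarrow> edge v u"
  using pair_sym_arcs by (auto simp: symmetric_def dest: symD)

sublocale adjacency edge
  by unfold_locales (auto simp: edge_sym dest: no_loops')

lemma two_K2_free_if_induced_free:
  assumes "induced_free two_K2 G"
  shows "two_K2_free (pverts G)"
  unfolding two_K2_free_def
proof (intro ballI impI, rule ccontr)
  fix a b c d
  assume V: "a \<in> pverts G" "b \<in> pverts G" "c \<in> pverts G" "d \<in> pverts G"
    and E: "edge a b" "edge c d"
    and N: "\<not> (edge a c \<or> edge a d \<or> edge b c \<or> edge b d)"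
  define f where "f = (\<lambda>i::nat. if i = 0 then a else if i = 1 then b else if i = 2 then c else d)"
  have E': "edge b a" "edge d c" "\<not> edge c a" "\<not> edge d a" "\<not> edge c b" "\<not> edge d b"
    using E N edge_sym by blast+
  have loop: "\<not> edge u u" for u by (rule adj_irrefl)
  \<comment> \<open>If the two edges shared an end, one of them would itself be an edge excluded by
    \<open>N\<close>.\<close>
  have "a \<noteq> b" "a \<noteq> c" "a \<noteq> d" "b \<noteq> c" "b \<noteq> d" "c \<noteq> d"
    using E E' N loop by auto
  then have inj: "inj_on f (pverts two_K2)"
    unfolding two_K2_def f_def by (auto simp: inj_on_def)
  interpret H: pair_graph two_K2 by (rule pair_graph_two_K2)
  show False
    using pair_wf_digraph_axioms H.pair_wf_digraph_axioms assms inj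
  proof (rule induced_free_no_embedding)
    show "f ` pverts two_K2 \<subseteq> pverts G"
      using V unfolding two_K2_def f_def by auto
    show "(u, v) \<in> parcs two_K2 \<longleftrightarrow> (f u, f v) \<in> parcs G"
      if "u \<in> pverts two_K2" "v \<in> pverts two_K2" for u v
      using that E E' N loop unfolding two_K2_def f_def by auto
  qed
qed

lemma claw_free_if_induced_free:
  assumes "induced_free claw G"
  shows "claw_free (pverts G)"
  unfolding claw_free_def
proof (intro ballI impI, rule ccontr)
  fix v a b c
  assume V: "v \<in> pverts G" "a \<in> pverts G" "b \<in> pverts G" "c \<in> pverts G"
    and E: "edge v a" "edge v b" "edge v c"
    and D: "a \<noteq> b" "b \<noteq> c" "a \<noteq> c"
    and N: "\<not> (edge a b \<or> edge b c \<or> edge a c)"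
  define f where "f = (\<lambda>i::nat. if i = 0 then v else if i = 1 then a else if i = 2 then b else c)"
  have E': "edge a v" "edge b v" "edge c v" "\<not> edge b a" "\<not> edge c b" "\<not> edge c a"
    using E N edge_sym by blast+
  have loop: "\<not> edge u u" for u by (rule adj_irrefl)
  have "v \<noteq> a" "v \<noteq> b" "v \<noteq> c"
    using E loop by auto
  then have inj: "inj_on f (pverts claw)"
    unfolding claw_def f_def using D by (auto simp: inj_on_def)
  have wf: "pair_wf_digraph claw"
    by unfold_locales (auto simp: claw_def)
  show False
    using pair_wf_digraph_axioms wf assms inj
  proof (rule induced_free_no_embedding)
    show "f ` pverts claw \<subseteq> pverts G"
      using V unfolding claw_def f_def by auto
    show "(u, w) \<in> parcs claw \<longleftrightarrow> (f u, f w) \<in> parcs G"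
      if "u \<in> pverts claw" "w \<in> pverts claw" for u w
      using that E E' N loop unfolding claw_def f_def by auto
  qed
qed

section \<open>Walks in the recoloring graph\<close>

lemma colorings_iff:
  "c \<in> colorings k G \<longleftrightarrow> proper (pverts G) {1..k} c \<and> c \<in> extensional (pverts G)"
  unfolding colorings_def proper_def PiE_iff using in_arcsD1 in_arcsD2 by (auto 4 3)

text \<open>Each move is an arc, except that a move keeping the color adds none; hence only an upper
  bound on the length.\<close>

lemma recol_imp_awalk:
  assumes "recol (pverts G) {1..k} c d m" "c \<in> colorings k G"
  shows "d \<in> colorings k G \<and> (\<exists>p. pre_digraph.awalk (with_proj (recoloring_graph k G)) c p d \<and>
    length p \<le> (\<Sum>v\<in>pverts G. m v))"
proof -
  interpret R: pair_graph "recoloring_graph k G"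
    using pair_graph_axioms by (rule pair_graph_recoloring_graph)
  have verts_R: "pverts (recoloring_graph k G) = colorings k G"
    by (simp add: recoloring_graph_def)
  show ?thesis
    using assms
  proof induction
    case (refl c)
    then show ?case by (auto simp: R.awalk_Nil_iff verts_R intro!: exI[of _ "[]"])
  next
    case (step c d m v x)
    then obtain p where p: "R.awalk c p d" "length p \<le> (\<Sum>v\<in>pverts G. m v)"
      and d: "d \<in> colorings k G" by blast
    have len: "(\<Sum>u\<in>pverts G. (m(v := Suc (m v))) u) = Suc (\<Sum>u\<in>pverts G. m u)"
      using step.hyps(2) pair_finite_verts by (simp add: sum.remove[of _ v])
    have d': "d(v := x) \<in> colorings k G"
      using d step.hyps(2,3) by (auto simp: colorings_iff extensional_def)
    have "\<exists>p. R.awalk c p (d(v := x)) \<and> length p \<le> Suc (\<Sum>u\<in>pverts G. m u)"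
    proof (cases "d v = x")
      case True
      then have "d(v := x) = d" by auto
      then show ?thesis using p by (intro exI[of _ p]) auto
    next
      case False
      then have "(d, d(v := x)) \<in> parcs (recoloring_graph k G)"
        using d d' step.hyps(2) by (auto simp: recoloring_graph_def)
      then have "R.awalk d [(d, d(v := x))] (d(v := x))"
        using d d' by (simp add: R.awalk_Cons_iff R.awalk_Nil_iff verts_R)
      with p(1) have "R.awalk c (p @ [(d, d(v := x))]) (d(v := x))"
        by (rule R.awalk_appendI)
      then show ?thesis using p(2) by (intro exI[of _ "p @ [(d, d(v := x))]"]) auto
    qed
    with d' show ?case unfolding len by (rule conjI)
  qed
qed

end

theorem theorem11:
  fixes G :: "'a pair_pre_digraph"
  assumes "pair_graph G"
    and "induced_free two_K2 G"
    and "induced_free claw G"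
  shows "recolorable G \<and>
    (\<forall>l \<ge> chromatic_number G + 1.
      graph_diameter (with_proj (recoloring_graph l G)) \<le> ereal (2 * real (card (pverts G)) ^ 2))"
proof -
  interpret pair_graph G by fact
  let ?n = "card (pverts G)"
  have main: "Digraph_Component.connected (with_proj (recoloring_graph l G)) \<and>
      graph_diameter (with_proj (recoloring_graph l G)) \<le> ereal (2 * real ?n ^ 2)"
    if l: "l \<ge> chromatic_number G + 1" for l
  proof -
    interpret R: pair_graph "recoloring_graph l G"
      using pair_graph_axioms by (rule pair_graph_recoloring_graph)
    have verts_R: "pverts (recoloring_graph l G) = colorings l G"
      by (simp add: recoloring_graph_def)
    obtain g where "g \<in> colorings (chromatic_number G) G"
      using colorings_chromatic_number[OF assms(1)] by blast
    then have g: "proper (pverts G) {1..chromatic_number G} g" and ext: "g \<in> extensional (pverts G)"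
      by (auto simp: colorings_iff)
    \<comment> \<open>The extra color in \<open>l\<close> makes the inequality \<open>small\<close>
      strict.\<close>
    have "card (g ` pverts G) \<le> card {1..chromatic_number G}"
      using g by (intro card_mono) (auto simp: proper_def)
    then have small: "card (g ` pverts G) < card {1..l}" using l by simp
    have g': "proper (pverts G) UNIV g" using g by (rule proper_mono) auto
    have g_l: "g \<in> colorings l G"
      using proper_mono[OF g, of "pverts G" "{1..l}"] l ext by (auto simp: colorings_iff)
    have walk: "\<exists>p. R.awalk c p d \<and> length p \<le> 2 * ?n ^ 2"
      if c: "c \<in> colorings l G" and d: "d \<in> colorings l G" for c d
    proof -
      have "c v = d v" if "v \<notin> pverts G" for v
        using c d that by (auto simp: colorings_iff extensional_def)
      then obtain m where m: "recol (pverts G) {1..l} c d m" "\<And>v. m v \<le> 2 * ?n"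
        using recol_between[OF pair_finite_verts two_K2_free_if_induced_free[OF assms(2)]
            claw_free_if_induced_free[OF assms(3)] _ _ _ g' small, of c d] c d
        by (auto simp: colorings_iff)
      \<comment> \<open>Each of the \<open>?n\<close> vertices moves at most \<open>2 * ?n\<close>
        times.\<close>
      have "(\<Sum>v\<in>pverts G. m v) \<le> ?n * (2 * ?n)"
        using sum_bounded_above[of "pverts G" m "2 * ?n"] m(2) by simp
      then show ?thesis
        using recol_imp_awalk[OF m(1) c] by (auto simp: power2_eq_square mult.left_commute intro: order_trans)
    qed
    have "Digraph_Component.connected (with_proj (recoloring_graph l G))"
      unfolding Digraph_Component.connected_def
    proof (rule strongly_connectedI)
      \<comment> \<open>Connectedness includes having a vertex, which \<open>g\<close>
        provides.\<close>
      show "verts (with_proj (mk_symmetric (with_proj (recoloring_graph l G)))) \<noteq> {}"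
        using g_l by (auto simp: mk_symmetric_def verts_R)
      fix c d
      assume "c \<in> verts (with_proj (mk_symmetric (with_proj (recoloring_graph l G))))"
        "d \<in> verts (with_proj (mk_symmetric (with_proj (recoloring_graph l G))))"
      then have "c \<rightarrow>\<^sup>*\<^bsub>with_proj (recoloring_graph l G)\<^esub> d"
        using walk[of c d] by (auto simp: mk_symmetric_def verts_R R.reachable_awalk)
      then show "c \<rightarrow>\<^sup>*\<^bsub>with_proj (mk_symmetric (with_proj (recoloring_graph l G)))\<^esub> d"
        by (rule R.reachable_mk_symmetricI)
    qed
    moreover have "graph_diameter (with_proj (recoloring_graph l G)) \<le> ereal (2 * real ?n ^ 2)"
      unfolding graph_diameter_def
    proof (intro SUP_least)
      fix c d
      assume "c \<in> verts (with_proj (recoloring_graph l G))" "d \<in> verts (with_proj (recoloring_graph l G))"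
      then obtain p where p: "R.awalk c p d" "length p \<le> 2 * ?n ^ 2"
        using walk[of c d] by (auto simp: verts_R)
      have "real (length p) \<le> real (2 * ?n ^ 2)"
        using p(2) by (simp only: of_nat_le_iff)
      moreover have "R.awalk_cost (\<lambda>_. 1) p = real (length p)"
        by (simp add: R.awalk_cost_def sum_list_triv)
      ultimately have "ereal (R.awalk_cost (\<lambda>_. 1) p) \<le> ereal (2 * real ?n ^ 2)"
        by simp
      with R.min_cost_le_walk_cost[OF p(1)] show "R.\<mu> (\<lambda>_. 1) c d \<le> ereal (2 * real ?n ^ 2)"
        by (rule order_trans)
    qed
    ultimately show ?thesis by blast
  qed
  then show ?thesis unfolding recolorable_def by blast
qed

end
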